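(* Let $X$ be a nonempty set, let $L$ be a truncated vector sublattice of $\mathbb{R}^{X}$, and let $\psi$ be a linear functional on $L$. Then the following are equivalent. (i) $\psi$ is a truncation homomorphism. (ii) $\psi$ is a lattice homomorphism and $\sup\{\psi(f) : f\in L \text{ and } f\leq \mathbf{1}_{X}\}=1$.
   Context: $\mathbb{R}^{X}$ is the set of all real-valued functions on the nonempty set $X$, with pointwise vector space operations and pointwise order, so $(f\wedge g)(x)=\min\{f(x),g(x)\}$. $\mathbf{1}_{X}$ is the constant function $1$ on $X$. A vector sublattice of $\mathbb{R}^{X}$ is a linear subspace closed under pointwise minimum and maximum. A truncated vector sublattice of $\mathbb{R}^{X}$ is a vector sublattice $L$ of $\mathbb{R}^{X}$ such that $f\wedge\mathbf{1}_{X}\in L$ for all $f\in L$ (it is not assumed that $\mathbf{1}_{X}\in L$). A truncation homomorphism on $L$ is a nonzero linear functional $\psi:L\to\mathbb{R}$ such that $\psi(f\wedge\mathbf{1}_{X})=\min\{\psi(f),1\}$ for all $f\in L$. A linear functional $\psi$ on $L$ is a lattice homomorphism if $\psi(f\wedge g)=\min\{\psi(f),\psi(g)\}$ for all $f,g\in L$. *)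

theory Defs
  imports Complex_Main "HOL-Library.Function_Algebras" "HOL-Library.Extended_Real"
begin

text \<open>
  The ground set \<open>X\<close> is the type \<open>'a\<close> (types are nonempty), so the functions from \<open>X\<close> to the
  reals are the elements of \<open>'a \<Rightarrow> real\<close>. Addition, zero, \<open>\<le>\<close>, \<open>inf\<close> and \<open>sup\<close> on this type
  are the pointwise ones of the library; only the scalar multiplication has to be added.
\<close>

instantiation "fun" :: (type, real_vector) real_vector
begin

definition scaleR_fun :: "real \<Rightarrow> ('a \<Rightarrow> 'b) \<Rightarrow> 'a \<Rightarrow> 'b"
  where "scaleR_fun c f = (\<lambda>x. c *\<^sub>R f x)"

instance
  by standard (auto simp: scaleR_fun_def fun_eq_iff scaleR_add_right scaleR_add_left)

end

definition vector_sublattice :: "('a \<Rightarrow> real) set \<Rightarrow> bool"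
  where "vector_sublattice L \<longleftrightarrow>
    subspace L \<and> (\<forall>f\<in>L. \<forall>g\<in>L. inf f g \<in> L \<and> sup f g \<in> L)"

definition truncated_vector_sublattice :: "('a \<Rightarrow> real) set \<Rightarrow> bool"
  where "truncated_vector_sublattice L \<longleftrightarrow>
    vector_sublattice L \<and> (\<forall>f\<in>L. inf f (\<lambda>_. 1) \<in> L)"

text \<open>
  A functional on \<open>L\<close> is represented by a function on all of \<open>'a \<Rightarrow> real\<close> of which only the
  restriction to \<open>L\<close> matters.
\<close>

definition linear_functional_on :: "('a \<Rightarrow> real) set \<Rightarrow> (('a \<Rightarrow> real) \<Rightarrow> real) \<Rightarrow> bool"
  where "linear_functional_on L \<psi> \<longleftrightarrow>
    (\<forall>f\<in>L. \<forall>g\<in>L. \<psi> (f + g) = \<psi> f + \<psi> g) \<and>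
    (\<forall>c. \<forall>f\<in>L. \<psi> (c *\<^sub>R f) = c * \<psi> f)"

definition truncation_homomorphism_on :: "('a \<Rightarrow> real) set \<Rightarrow> (('a \<Rightarrow> real) \<Rightarrow> real) \<Rightarrow> bool"
  where "truncation_homomorphism_on L \<psi> \<longleftrightarrow>
    linear_functional_on L \<psi> \<and> (\<exists>f\<in>L. \<psi> f \<noteq> 0) \<and>
    (\<forall>f\<in>L. \<psi> (inf f (\<lambda>_. 1)) = min (\<psi> f) 1)"

definition lattice_homomorphism_on :: "('a \<Rightarrow> real) set \<Rightarrow> (('a \<Rightarrow> real) \<Rightarrow> real) \<Rightarrow> bool"
  where "lattice_homomorphism_on L \<psi> \<longleftrightarrow>
    linear_functional_on L \<psi> \<and>
    (\<forall>f\<in>L. \<forall>g\<in>L. \<psi> (inf f g) = min (\<psi> f) (\<psi> g))"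

end

theory Submission imports Defs begin

text \<open>
  For a truncation homomorphism \<open>\<psi>\<close>, scaling gives \<open>\<psi> (f \<and> t) = min (\<psi> f) t\<close> for every
  constant \<open>t > 0\<close>. Apply this to both terms on the right of
  \<open>f \<and> 0 = (f \<and> t) - (f\<^sup>+ \<and> t)\<close> and let \<open>t\<close> tend to \<open>0\<close> to obtain \<open>\<psi> (f \<and> 0) = min (\<psi> f) 0\<close>,
  and hence that \<open>\<psi>\<close> preserves binary minima by translation. The supremum is attained at
  \<open>f \<and> 1\<close> for any \<open>f\<close> with \<open>\<psi> f = 1\<close>.
  Conversely, a lattice homomorphism satisfies \<open>min (\<psi> f) (\<psi> g) \<le> \<psi> (f \<and> 1)\<close> whenever \<open>g \<le> 1\<close>,
  and taking the supremum over \<open>g\<close> gives \<open>min (\<psi> f) 1 \<le> \<psi> (f \<and> 1)\<close>.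
\<close>

lemma linear_functional_on_diff:
  assumes "subspace L" "linear_functional_on L \<psi>" "f \<in> L" "g \<in> L"
  shows "\<psi> (f - g) = \<psi> f - \<psi> g"
proof -
  have "\<psi> (f - g) + \<psi> g = \<psi> (f - g + g)"
    using assms subspace_diff[of L f g] unfolding linear_functional_on_def by metis
  then show ?thesis by simp
qed

lemma lattice_homomorphism_on_mono:
  assumes "lattice_homomorphism_on L \<psi>" "f \<in> L" "g \<in> L" "f \<le> g"
  shows "\<psi> f \<le> \<psi> g"
proof -
  have "inf f g = f" using assms(4) by (rule inf_absorb1)
  then have "\<psi> f = min (\<psi> f) (\<psi> g)"
    using assms unfolding lattice_homomorphism_on_def by metis
  then show ?thesis by linarith
qed

text \<open>Reduces truncation at an arbitrary positive height to truncation at height 1, the only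
  one under which \<open>L\<close> is assumed closed.\<close>

lemma inf_const_eq_scaleR:
  fixes f :: "'a \<Rightarrow> real"
  assumes "t > 0"
  shows "inf f (\<lambda>_. t) = t *\<^sub>R inf ((1 / t) *\<^sub>R f) (\<lambda>_. 1)"
  using assms by (auto simp: fun_eq_iff scaleR_fun_def inf_min min_def field_simps)

lemma truncation_homomorphism_on_inf_const:
  assumes L: "truncated_vector_sublattice L" and \<psi>: "truncation_homomorphism_on L \<psi>"
    and f: "f \<in> L" and t: "t > 0"
  shows "inf f (\<lambda>_. t) \<in> L" "\<psi> (inf f (\<lambda>_. t)) = min (\<psi> f) t"
proof -
  have sub: "subspace L"
    using L by (simp add: truncated_vector_sublattice_def vector_sublattice_def)
  have scaled: "(1 / t) *\<^sub>R f \<in> L" using sub f by (rule subspace_scale)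
  then have trunc: "inf ((1 / t) *\<^sub>R f) (\<lambda>_. 1) \<in> L"
    using L by (simp add: truncated_vector_sublattice_def)
  then show "inf f (\<lambda>_. t) \<in> L"
    unfolding inf_const_eq_scaleR[OF t] by (rule subspace_scale[OF sub])
  have "\<psi> (inf f (\<lambda>_. t)) = t * \<psi> (inf ((1 / t) *\<^sub>R f) (\<lambda>_. 1))"
    unfolding inf_const_eq_scaleR[OF t]
    using \<psi> trunc by (simp add: truncation_homomorphism_on_def linear_functional_on_def)
  also have "\<dots> = t * min (\<psi> f / t) 1"
    using \<psi> scaled f by (simp add: truncation_homomorphism_on_def linear_functional_on_def)
  also have "\<dots> = min (\<psi> f) t"
    using t by (auto simp: min_def field_simps)
  finally show "\<psi> (inf f (\<lambda>_. t)) = min (\<psi> f) t" .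
qed

lemma truncation_homomorphism_on_le_1:
  assumes "truncation_homomorphism_on L \<psi>" "f \<in> L" "f \<le> (\<lambda>_. 1)"
  shows "\<psi> f \<le> 1"
proof -
  have "inf f (\<lambda>_. 1) = f" using assms(3) by (rule inf_absorb1)
  then have "\<psi> f = min (\<psi> f) 1"
    using assms unfolding truncation_homomorphism_on_def by metis
  then show ?thesis by linarith
qed

text \<open>All positive multiples of a nonpositive function lie below 1, so their values stay
  bounded by 1; hence a nonpositive function cannot have a positive value.\<close>

lemma truncation_homomorphism_on_nonneg:
  assumes L: "truncated_vector_sublattice L" and \<psi>: "truncation_homomorphism_on L \<psi>"
    and f: "f \<in> L" "0 \<le> f"
  shows "0 \<le> \<psi> f"
proof (rule ccontr)
  assume neg: "\<not> 0 \<le> \<psi> f"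
  \<comment> \<open>the functional takes the value \<open>2\<close> at \<open>c f\<close>, although \<open>c f \<le> 0\<close>\<close>
  define c where "c = 2 / \<psi> f"
  have "c < 0" using neg by (simp add: c_def divide_pos_neg)
  have "c *\<^sub>R f \<in> L"
    using L f by (simp add: truncated_vector_sublattice_def vector_sublattice_def subspace_scale)
  moreover have "(c *\<^sub>R f) x \<le> 1" for x
  proof -
    have "c * f x \<le> 0"
      using \<open>c < 0\<close> f(2) by (simp add: le_fun_def mult_nonpos_nonneg)
    then show ?thesis by (simp add: scaleR_fun_def)
  qed
  ultimately have "\<psi> (c *\<^sub>R f) \<le> 1"
    using truncation_homomorphism_on_le_1[OF \<psi>] by (simp add: le_fun_def)
  moreover have "\<psi> (c *\<^sub>R f) = 2"
    using \<psi> f neg by (simp add: truncation_homomorphism_on_def linear_functional_on_def c_def)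
  ultimately show False by simp
qed

lemma truncation_homomorphism_on_inf_zero:
  assumes L: "truncated_vector_sublattice L" and \<psi>: "truncation_homomorphism_on L \<psi>"
    and f: "f \<in> L"
  shows "\<psi> (inf f 0) = min (\<psi> f) 0"
proof -
  have sub: "subspace L"
    using L by (simp add: truncated_vector_sublattice_def vector_sublattice_def)
  have lin: "linear_functional_on L \<psi>"
    using \<psi> by (simp add: truncation_homomorphism_on_def)
  have pos: "sup f 0 \<in> L"
    using L f subspace_0[OF sub]
    by (simp add: truncated_vector_sublattice_def vector_sublattice_def)
  have pos_nonneg: "0 \<le> \<psi> (sup f 0)"
    by (rule truncation_homomorphism_on_nonneg[OF L \<psi> pos]) simp
  have close: "\<bar>\<psi> (inf f 0) - min (\<psi> f) 0\<bar> \<le> t" if t: "t > 0" for t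
  proof -
    \<comment> \<open>Where \<open>f\<close> is nonnegative the two truncations agree and cancel;
      where it is negative the first is \<open>f\<close> and the second is 0.\<close>
    have "inf f 0 = inf f (\<lambda>_. t) - inf (sup f 0) (\<lambda>_. t)"
      using t by (auto simp: fun_eq_iff inf_min sup_max min_def max_def)
    then have "\<psi> (inf f 0) = min (\<psi> f) t - min (\<psi> (sup f 0)) t"
      using linear_functional_on_diff[OF sub lin]
        truncation_homomorphism_on_inf_const[OF L \<psi> f t]
        truncation_homomorphism_on_inf_const[OF L \<psi> pos t] by metis
    \<comment> \<open>Both \<open>min (\<psi> f) t - min (\<psi> f) 0\<close> and
      \<open>min (\<psi> (sup f 0)) t\<close> lie between 0 and \<open>t\<close>, the latter by
      positivity, so they differ by at most \<open>t\<close>.\<close>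
    then show ?thesis using t pos_nonneg by linarith
  qed
  have "\<bar>\<psi> (inf f 0) - min (\<psi> f) 0\<bar> \<le> 0"
    by (rule field_le_epsilon) (use close in simp)
  then show ?thesis by simp
qed

lemma truncation_imp_lattice_homomorphism_on:
  assumes L: "truncated_vector_sublattice L" and \<psi>: "truncation_homomorphism_on L \<psi>"
  shows "lattice_homomorphism_on L \<psi>"
  unfolding lattice_homomorphism_on_def
proof (intro conjI ballI)
  show lin: "linear_functional_on L \<psi>"
    using \<psi> by (simp add: truncation_homomorphism_on_def)
  fix f g assume f: "f \<in> L" and g: "g \<in> L"
  have sub: "subspace L" and inf_zero: "inf (f - g) 0 \<in> L"
    using L f g
    by (simp_all add: truncated_vector_sublattice_def vector_sublattice_def subspace_diff
        subspace_0)
  have "inf f g = g + inf (f - g) 0"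
    by (auto simp: fun_eq_iff inf_min min_def)
  then have "\<psi> (inf f g) = \<psi> g + \<psi> (inf (f - g) 0)"
    using lin g inf_zero by (simp add: linear_functional_on_def)
  also have "\<dots> = \<psi> g + min (\<psi> f - \<psi> g) 0"
    using truncation_homomorphism_on_inf_zero[OF L \<psi> subspace_diff[OF sub f g]]
      linear_functional_on_diff[OF sub lin f g] by simp
  finally show "\<psi> (inf f g) = min (\<psi> f) (\<psi> g)" by linarith
qed

lemma truncation_homomorphism_on_SUP:
  assumes L: "truncated_vector_sublattice L" and \<psi>: "truncation_homomorphism_on L \<psi>"
  shows "(SUP f\<in>{f \<in> L. f \<le> (\<lambda>_. 1)}. ereal (\<psi> f)) = 1"
proof (rule antisym)
  show "(SUP f\<in>{f \<in> L. f \<le> (\<lambda>_. 1)}. ereal (\<psi> f)) \<le> 1"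
    using truncation_homomorphism_on_le_1[OF \<psi>] by (auto intro!: SUP_least)
  obtain h where h: "h \<in> L" "\<psi> h \<noteq> 0"
    using \<psi> by (auto simp: truncation_homomorphism_on_def)
  \<comment> \<open>Normalised to have value exactly 1, which truncation at 1 then leaves
    unchanged.\<close>
  define g where "g = (1 / \<psi> h) *\<^sub>R h"
  have g: "g \<in> L"
    using L h
    by (simp add: g_def truncated_vector_sublattice_def vector_sublattice_def subspace_scale)
  have "\<psi> g = 1"
    using \<psi> h by (simp add: g_def truncation_homomorphism_on_def linear_functional_on_def)
  then have "\<psi> (inf g (\<lambda>_. 1)) = 1"
    using \<psi> g by (simp add: truncation_homomorphism_on_def)
  moreover have "inf g (\<lambda>_. 1) \<in> {f \<in> L. f \<le> (\<lambda>_. 1)}"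
    using L g by (simp add: truncated_vector_sublattice_def)
  ultimately show "1 \<le> (SUP f\<in>{f \<in> L. f \<le> (\<lambda>_. 1)}. ereal (\<psi> f))"
    using SUP_upper[of "inf g (\<lambda>_. 1)" "{f \<in> L. f \<le> (\<lambda>_. 1)}" "\<lambda>f. ereal (\<psi> f)"]
    by (simp add: one_ereal_def)
qed

lemma lattice_imp_truncation_homomorphism_on:
  assumes L: "truncated_vector_sublattice L" and \<psi>: "lattice_homomorphism_on L \<psi>"
    and SUP: "(SUP f\<in>{f \<in> L. f \<le> (\<lambda>_. 1)}. ereal (\<psi> f)) = 1"
  shows "truncation_homomorphism_on L \<psi>"
proof -
  have lin: "linear_functional_on L \<psi>"
    using \<psi> by (simp add: lattice_homomorphism_on_def)
  \<comment> \<open>The supremum is formed in \<open>ereal\<close>, where it always exists, so its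
    being 1 includes boundedness; in \<open>real\<close> the supremum of an unbounded set would be
    an unspecified value.\<close>
  have upper: "\<psi> g \<le> 1" if "g \<in> L" "g \<le> (\<lambda>_. 1)" for g
    using SUP_upper[of g "{f \<in> L. f \<le> (\<lambda>_. 1)}" "\<lambda>f. ereal (\<psi> f)"] that SUP by simp
  have approx: "\<exists>g\<in>L. g \<le> (\<lambda>_. 1) \<and> y < \<psi> g" if "y < 1" for y
  proof -
    have "ereal y < (SUP f\<in>{f \<in> L. f \<le> (\<lambda>_. 1)}. ereal (\<psi> f))"
      using SUP that by simp
    then show ?thesis unfolding less_SUP_iff by auto
  qed
  \<comment> \<open>A supremum above 0 forces some strictly positive value.\<close>
  have nonzero: "\<exists>f\<in>L. \<psi> f \<noteq> 0"
    using approx[of 0] by force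
  have "\<psi> (inf f (\<lambda>_. 1)) = min (\<psi> f) 1" if f: "f \<in> L" for f
  proof (rule antisym)
    have trunc: "inf f (\<lambda>_. 1) \<in> L"
      using L f by (simp add: truncated_vector_sublattice_def)
    show "\<psi> (inf f (\<lambda>_. 1)) \<le> min (\<psi> f) 1"
      using lattice_homomorphism_on_mono[OF \<psi> trunc f] upper[OF trunc] by simp
    show "min (\<psi> f) 1 \<le> \<psi> (inf f (\<lambda>_. 1))"
    \<comment> \<open>The supremum is not yet known to be attained, so the bound is tested against
      each \<open>y\<close> below it; some \<open>g\<close> below 1 has value above
      \<open>y\<close>, and then so does \<open>inf f g\<close>.\<close>
    proof (rule dense_le)
      fix y assume y: "y < min (\<psi> f) 1"
      then obtain g where g: "g \<in> L" "g \<le> (\<lambda>_. 1)" "y < \<psi> g"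
        using approx[of y] by auto
      have "inf f g \<in> L"
        using L f g by (simp add: truncated_vector_sublattice_def vector_sublattice_def)
      moreover have "inf f g \<le> inf f (\<lambda>_. 1)"
        using g(2) by (rule inf_mono[OF order_refl])
      ultimately have "\<psi> (inf f g) \<le> \<psi> (inf f (\<lambda>_. 1))"
        using lattice_homomorphism_on_mono[OF \<psi> _ trunc] by blast
      moreover have "\<psi> (inf f g) = min (\<psi> f) (\<psi> g)"
        using \<psi> f g by (simp add: lattice_homomorphism_on_def)
      ultimately show "y \<le> \<psi> (inf f (\<lambda>_. 1))" using y g(3) by linarith
    qed
  qed
  then show ?thesis
    using lin nonzero by (simp add: truncation_homomorphism_on_def)
qed

theorem theorem2p4:
  fixes L :: "('a \<Rightarrow> real) set" and \<psi> :: "('a \<Rightarrow> real) \<Rightarrow> real"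
  assumes "truncated_vector_sublattice L"
    and "linear_functional_on L \<psi>"
  shows "truncation_homomorphism_on L \<psi> \<longleftrightarrow>
    lattice_homomorphism_on L \<psi> \<and>
    (SUP f\<in>{f \<in> L. f \<le> (\<lambda>_. 1)}. ereal (\<psi> f)) = 1"
proof (intro iffI conjI)
  assume \<psi>: "truncation_homomorphism_on L \<psi>"
  show "lattice_homomorphism_on L \<psi>"
    by (rule truncation_imp_lattice_homomorphism_on[OF assms(1) \<psi>])
  show "(SUP f\<in>{f \<in> L. f \<le> (\<lambda>_. 1)}. ereal (\<psi> f)) = 1"
    by (rule truncation_homomorphism_on_SUP[OF assms(1) \<psi>])
next
  assume "lattice_homomorphism_on L \<psi> \<and>
    (SUP f\<in>{f \<in> L. f \<le> (\<lambda>_. 1)}. ereal (\<psi> f)) = 1"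
  then show "truncation_homomorphism_on L \<psi>"
    using lattice_imp_truncation_homomorphism_on[OF assms(1)] by simp
qed

end
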